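(* Let $G$ be a circular arc graph whose maximum circular cover number satisfies $L_{max}(G) > 4$. Then $box(G) \leq 3$.
   Context: All graphs are simple, finite and undirected. A circular arc graph is a graph that is the intersection graph of a family of arcs on a circle: each vertex is assigned an arc, and two distinct vertices are adjacent if and only if their arcs intersect. (The whole circle and single points are not considered to be arcs.) For a family $F$ of arcs on a circle, a circular cover is a subset of arcs of $F$ whose union is the whole circle. The circular cover number $L(F)$ is the cardinality of a minimum circular cover; if $F$ has no circular cover then $L(F) = \infty$. The maximum circular cover number $L_{max}(G)$ is the maximum value of $L(F)$ over all families of arcs $F$ that represent $G$. A $k$-dimensional box (or $k$-box) is a Cartesian product $R_1 \times \cdots \times R_k$ where each $R_i$ is a closed interval on the real line. The boxicity $box(G)$ of a graph $G$ is the minimum integer $k$ such that $G$ is the intersection graph of a family of $k$-boxes (one box per vertex; two distinct vertices are adjacent if and only if their boxes intersect). *)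

theory Defs
  imports "HOL-Analysis.Analysis"
begin

definition simple_graph :: "'a set \<Rightarrow> 'a set set \<Rightarrow> bool" where
  "simple_graph V E \<longleftrightarrow>
     finite V \<and> (\<forall>e\<in>E. \<exists>u\<in>V. \<exists>v\<in>V. u \<noteq> v \<and> e = {u, v})"

text \<open>A family of sets indexed by the vertices represents the graph as its intersection graph;
  distinct vertices may be assigned the same set.\<close>

definition intersection_representation ::
    "'a set \<Rightarrow> 'a set set \<Rightarrow> ('a \<Rightarrow> 'b set) \<Rightarrow> bool" where
  "intersection_representation V E F \<longleftrightarrow>
     (\<forall>u\<in>V. \<forall>v\<in>V. u \<noteq> v \<longrightarrow> ({u, v} \<in> E \<longleftrightarrow> F u \<inter> F v \<noteq> {}))"

text \<open>Arcs are closed arcs of the unit circle. The strict inequalities exclude single points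
  and the whole circle.\<close>

definition circle_arc :: "complex set \<Rightarrow> bool" where
  "circle_arc A \<longleftrightarrow> (\<exists>a b. a < b \<and> b < a + 2 * pi \<and> A = cis ` {a..b})"

definition arc_representation ::
    "'a set \<Rightarrow> 'a set set \<Rightarrow> ('a \<Rightarrow> complex set) \<Rightarrow> bool" where
  "arc_representation V E F \<longleftrightarrow>
     (\<forall>v\<in>V. circle_arc (F v)) \<and> intersection_representation V E F"

definition circular_arc_graph :: "'a set \<Rightarrow> 'a set set \<Rightarrow> bool" where
  "circular_arc_graph V E \<longleftrightarrow> simple_graph V E \<and> (\<exists>F. arc_representation V E F)"

definition circular_cover :: "'a set \<Rightarrow> ('a \<Rightarrow> complex set) \<Rightarrow> complex set set \<Rightarrow> bool" where
  "circular_cover V F S \<longleftrightarrow> S \<subseteq> F ` V \<and> \<Union>S = sphere 0 1"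

text \<open>The infimum over the empty set is \<open>\<infinity>\<close>, the value for a family without a circular cover.\<close>

definition circular_cover_number :: "'a set \<Rightarrow> ('a \<Rightarrow> complex set) \<Rightarrow> enat" where
  "circular_cover_number V F = (INF S \<in> {S. circular_cover V F S}. enat (card S))"

text \<open>For a circular arc graph on \<open>n\<close> vertices the supremum is a maximum: each value is
  \<open>\<infinity>\<close> or at most \<open>n\<close>.\<close>

definition max_circular_cover_number :: "'a set \<Rightarrow> 'a set set \<Rightarrow> enat" where
  "max_circular_cover_number V E =
     (SUP F \<in> {F. arc_representation V E F}. circular_cover_number V F)"

text \<open>Points of \<open>k\<close>-dimensional space are extensional functions on \<open>{..<k}\<close>, so that \<open>k\<close> can be
  minimised over.\<close>

definition k_box :: "nat \<Rightarrow> (nat \<Rightarrow> real) set \<Rightarrow> bool" where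
  "k_box k B \<longleftrightarrow>
     (\<exists>l r. (\<forall>i<k. l i \<le> r i) \<and> B = (\<Pi>\<^sub>E i\<in>{..<k}. {l i..r i}))"

definition box_representation ::
    "nat \<Rightarrow> 'a set \<Rightarrow> 'a set set \<Rightarrow> ('a \<Rightarrow> (nat \<Rightarrow> real) set) \<Rightarrow> bool" where
  "box_representation k V E F \<longleftrightarrow>
     (\<forall>v\<in>V. k_box k (F v)) \<and> intersection_representation V E F"

definition boxicity :: "'a set \<Rightarrow> 'a set set \<Rightarrow> nat" where
  "boxicity V E = (LEAST k. \<exists>F. box_representation k V E F)"

text \<open>The minimum in the definition of \<open>boxicity\<close> exists for every finite graph.\<close>

lemma box_representation_exists:
  assumes "simple_graph V E"
  shows "\<exists>k F. box_representation k V E F"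
proof -
  have "finite V"
    using assms by (simp add: simple_graph_def)
  then obtain w where w: "bij_betw w {..<card V} V"
    using bij_betw_from_nat_into_finite by blast
  define l :: "'a \<Rightarrow> nat \<Rightarrow> real"
    where "l = (\<lambda>v i. if v = w i \<or> {v, w i} \<in> E then 0 else 1)"
  define r :: "'a \<Rightarrow> nat \<Rightarrow> real"
    where "r = (\<lambda>v i. if v = w i then 0 else 1)"
  define F where "F = (\<lambda>v. \<Pi>\<^sub>E i\<in>{..<card V}. {l v i..r v i})"
  have meet: "F u \<inter> F v \<noteq> {} \<longleftrightarrow> (\<forall>i<card V. max (l u i) (l v i) \<le> min (r u i) (r v i))" for u v
  proof -
    have "F u \<inter> F v = (\<Pi>\<^sub>E i\<in>{..<card V}. {l u i..r u i} \<inter> {l v i..r v i})"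
      by (simp add: F_def PiE_Int)
    then show ?thesis
      by (auto simp: PiE_eq_empty_iff)
  qed
  have "{u, v} \<in> E \<longleftrightarrow> F u \<inter> F v \<noteq> {}" if uv: "u \<in> V" "v \<in> V" "u \<noteq> v" for u v
  proof
    assume "{u, v} \<in> E"
    then show "F u \<inter> F v \<noteq> {}"
      unfolding meet using uv by (auto simp: l_def r_def insert_commute)
  next
    assume *: "F u \<inter> F v \<noteq> {}"
    obtain i where i: "i < card V" "w i = u"
      using w uv by (metis bij_betw_imp_surj_on imageE lessThan_iff)
    with * have "max (l u i) (l v i) \<le> min (r u i) (r v i)"
      unfolding meet by blast
    then show "{u, v} \<in> E"
      using i uv by (auto simp: l_def r_def insert_commute split: if_splits)
  qed
  moreover have "k_box (card V) (F v)" for v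
    unfolding k_box_def F_def
    by (rule exI[of _ "l v"], rule exI[of _ "r v"]) (auto simp: l_def r_def)
  ultimately show ?thesis
    unfolding box_representation_def intersection_representation_def by blast
qed

end

(* Cut the circle at the point 1. The arcs through 1 form a clique K, the other arcs are
   intervals of (0, 2 pi). Three interval supergraphs suffice: the first keeps the intervals and
   makes K universal, which gives all non-edges outside K. An arc v outside K can meet members
   of K at its left end or at its right end, but not both: otherwise v and two members of K
   would cover the circle. So the non-edges between v and K are decided by one end of v
   alone, and each of the two remaining interval graphs takes care of one kind of v. *)

theory Submission
  imports Defs
begin

lemma cis_eq_iff: "cis x = cis y \<longleftrightarrow> (\<exists>k::int. x = y + 2 * pi * of_int k)"
proof -
  have "cis x = cis y \<longleftrightarrow> sin x = sin y \<and> cos x = cos y"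
    by (auto simp: complex_eq_iff)
  also have "\<dots> \<longleftrightarrow> (\<exists>k::int. x = y + 2 * pi * of_int k)"
    by (simp add: sin_cos_eq_iff mult_ac)
  finally show ?thesis .
qed

lemma cis_image_shift: "cis ` {a + 2 * pi * of_int k..b + 2 * pi * of_int k} = cis ` {a..b}"
proof -
  have "{a + 2 * pi * of_int k..b + 2 * pi * of_int k} = (\<lambda>x. x + 2 * pi * of_int k) ` {a..b}"
    by simp
  moreover have "cis (x + 2 * pi * of_int k) = cis x" for x
    using cis_eq_iff by blast
  ultimately show ?thesis
    by (simp only: image_image)
qed

text \<open>Angles may be moved by whole turns without changing the arc. The two alternatives in the
  last conclusion separate the arcs that contain the point 1 from those that avoid it.\<close>

lemma circle_arc_cut_at_one:
  assumes "circle_arc A"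
  obtains a b where "A = cis ` {a..b}" "a < b" "b < a + 2 * pi"
    "a \<le> 0 \<and> 0 \<le> b \<or> 0 < a \<and> b < 2 * pi"
proof -
  obtain a0 b0 where A: "A = cis ` {a0..b0}" and ab0: "a0 < b0" "b0 < a0 + 2 * pi"
    using assms by (auto simp: circle_arc_def)
  \<comment> \<open>This number of turns brings the left end into \<open>(-2 pi, 0]\<close>. If the
    right end is then still negative, one more turn places the whole interval inside
    \<open>(0, 2 pi)\<close>.\<close>
  define k where "k = - \<lceil>a0 / (2 * pi)\<rceil>"
  define a where "a = a0 + 2 * pi * of_int k"
  define b where "b = b0 + 2 * pi * of_int k"
  have Aab: "A = cis ` {a..b}"
    unfolding A a_def b_def by (rule cis_image_shift [symmetric])
  have ab: "a < b" "b < a + 2 * pi"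
    using ab0 by (auto simp: a_def b_def)
  have "a0 / (2 * pi) \<le> - of_int k" "- of_int k < a0 / (2 * pi) + 1"
    unfolding k_def by linarith+
  then have "a \<le> 0" "- (2 * pi) < a"
    by (auto simp: a_def field_simps)
  show ?thesis
  proof (cases "0 \<le> b")
    case True
    then show ?thesis
      using that[OF Aab ab] \<open>a \<le> 0\<close> by blast
  next
    case False
    have "A = cis ` {a + 2 * pi..b + 2 * pi}"
      using cis_image_shift[of a 1 b] Aab by simp
    then show ?thesis
      using that[of "a + 2 * pi" "b + 2 * pi"] ab \<open>- (2 * pi) < a\<close> False by auto
  qed
qed

text \<open>Holds because \<open>cis\<close> is injective on the open interval
  \<open>(0, 2 pi)\<close>.\<close>

lemma cis_images_meet_iff_intervals_meet:
  assumes "0 < a" "b < 2 * pi" "0 < c" "d < 2 * pi"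
  shows "cis ` {a..b} \<inter> cis ` {c..d} \<noteq> {} \<longleftrightarrow> {a..b} \<inter> {c..d} \<noteq> {}"
proof -
  have "inj_on cis {0<..<2 * pi}"
  proof (rule inj_onI)
    fix x y assume xy: "x \<in> {0<..<2 * pi}" "y \<in> {0<..<2 * pi}" and "cis x = cis y"
    then obtain k :: int where k: "x = y + 2 * pi * of_int k"
      using cis_eq_iff by blast
    then have "2 * pi * of_int k < 2 * pi * 1" "2 * pi * (-1) < 2 * pi * of_int k"
      using xy
      by (simp_all only: greaterThanLessThan_iff) linarith+
    then have "of_int k < (1::real)" "(-1::real) < of_int k"
      by (simp_all only: mult_less_cancel_left_pos[of "2 * pi"] mult_pos_pos zero_less_numeral pi_gt_zero)
    then have "k = 0"
      by linarith
    then show "x = y"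
      using k by simp
  qed
  then have "cis ` {a..b} \<inter> cis ` {c..d} = cis ` ({a..b} \<inter> {c..d})"
    using assms by (intro inj_on_image_Int [symmetric, of _ "{0<..<2 * pi}"]) auto
  then show ?thesis
    by simp
qed

text \<open>Angles of a common point, one taken from each interval, differ by a whole number of
  turns, and the bounds leave only 0 or 1. No turn means contact at the left end \<open>c\<close>,
  one turn means contact at the right end \<open>d\<close>.\<close>

lemma arc_through_one_meets_iff:
  assumes "a \<le> 0" "0 \<le> b" "b < a + 2 * pi" "0 < c" "c < d" "d < 2 * pi"
  shows "cis ` {a..b} \<inter> cis ` {c..d} \<noteq> {} \<longleftrightarrow> c \<le> b \<or> a + 2 * pi \<le> d"
proof
  assume "cis ` {a..b} \<inter> cis ` {c..d} \<noteq> {}"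
  then obtain z where "z \<in> cis ` {a..b}" "z \<in> cis ` {c..d}"
    by blast
  then obtain x y where xy: "x \<in> {a..b}" "y \<in> {c..d}" and "cis y = cis x"
    by (elim imageE) simp
  then obtain k :: int where k: "y = x + 2 * pi * of_int k"
    using cis_eq_iff by blast
  have "2 * pi * (-1) < 2 * pi * of_int k" "2 * pi * of_int k < 2 * pi * 2"
    using k xy assms by (simp_all only: atLeastAtMost_iff) linarith+
  then have "(-1::real) < of_int k" "of_int k < (2::real)"
    by (simp_all only: mult_less_cancel_left_pos[of "2 * pi"] mult_pos_pos zero_less_numeral pi_gt_zero)
  then have "k = 0 \<or> k = 1"
    by linarith
  then show "c \<le> b \<or> a + 2 * pi \<le> d"
    using k xy by auto
next
  assume "c \<le> b \<or> a + 2 * pi \<le> d"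
  then show "cis ` {a..b} \<inter> cis ` {c..d} \<noteq> {}"
  proof
    assume "c \<le> b"
    then have "cis c \<in> cis ` {a..b} \<inter> cis ` {c..d}"
      using assms by auto
    then show ?thesis
      by blast
  next
    assume "a + 2 * pi \<le> d"
    then have "cis (d - 2 * pi) \<in> cis ` {a..b}"
      using assms by simp
    moreover have "cis d = cis (d - 2 * pi)"
      using cis_eq_iff[of d "d - 2 * pi"] by (auto intro: exI[of _ 1])
    moreover have "cis d \<in> cis ` {c..d}"
      using assms by simp
    ultimately have "cis d \<in> cis ` {a..b} \<inter> cis ` {c..d}"
      by simp
    then show ?thesis
      by blast
  qed
qed

text \<open>Travelling once around from the point 1, the first arc reaches at least to
  \<open>c\<close>, the third continues to \<open>d\<close>, and the second, moved by one turn,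
  closes the rest up to \<open>2 * pi\<close>.\<close>

lemma three_arcs_cover:
  assumes "a \<le> 0" "0 \<le> b" "a' \<le> 0" "0 \<le> b'" "c \<le> b" "a' + 2 * pi \<le> d"
  shows "cis ` {a..b} \<union> cis ` {a'..b'} \<union> cis ` {c..d} = sphere 0 1"
proof
  show "sphere 0 1 \<subseteq> cis ` {a..b} \<union> cis ` {a'..b'} \<union> cis ` {c..d}"
  proof
    fix z :: complex assume "z \<in> sphere 0 1"
    then obtain t where t: "0 \<le> t" "t < 2 * pi" and z: "z = cis t"
      by (metis Arg2pi Arg2pi_eq cis_conv_exp mem_sphere_0 mult.commute mult_1 of_real_1)
    consider "t \<le> b" | "c \<le> t" "t \<le> d" | "d < t"
      using assms by linarith
    then show "z \<in> cis ` {a..b} \<union> cis ` {a'..b'} \<union> cis ` {c..d}"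
    proof cases
      case 3
      have "z = cis (t - 2 * pi)"
        unfolding z using cis_eq_iff[of t "t - 2 * pi"] by (auto intro: exI[of _ 1])
      moreover have "t - 2 * pi \<in> {a'..b'}"
        using 3 t assms by auto
      ultimately show ?thesis
        by blast
    qed (use z t assms in auto)
  qed
qed auto

text \<open>Such a cover would have at most three members, fewer if some of the arcs
  coincide.\<close>

lemma three_arcs_not_cover:
  assumes "circular_cover_number V F > 4" "u \<in> V" "v \<in> V" "w \<in> V"
  shows "F u \<union> F v \<union> F w \<noteq> sphere 0 1"
proof
  assume "F u \<union> F v \<union> F w = sphere 0 1"
  then have "circular_cover V F {F u, F v, F w}"
    using assms by (auto simp: circular_cover_def)
  then have "circular_cover_number V F \<le> enat (card {F u, F v, F w})"
    unfolding circular_cover_number_def by (intro INF_lower) simp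
  also have "card {F u, F v, F w} \<le> 3"
    by (simp add: card_insert_if)
  then have "enat (card {F u, F v, F w}) \<le> 4"
    by (simp add: numeral_eq_enat)
  finally show False
    using assms(1) by simp
qed

lemma box_meet_iff:
  fixes l r l' r' :: "nat \<Rightarrow> real"
  shows "(\<Pi>\<^sub>E i\<in>{..<k}. {l i..r i}) \<inter> (\<Pi>\<^sub>E i\<in>{..<k}. {l' i..r' i}) \<noteq> {} \<longleftrightarrow>
    (\<forall>i<k. {l i..r i} \<inter> {l' i..r' i} \<noteq> {})"
  unfolding PiE_Int PiE_eq_empty_iff by blast

text \<open>Boxes meet exactly when they meet in every coordinate, so it suffices to write the graph
  as the intersection of \<open>k\<close> interval graphs.\<close>

lemma boxicity_le:
  fixes l r :: "'a \<Rightarrow> nat \<Rightarrow> real"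
  assumes "\<And>v i. v \<in> V \<Longrightarrow> i < k \<Longrightarrow> l v i \<le> r v i"
    and "\<And>u v. u \<in> V \<Longrightarrow> v \<in> V \<Longrightarrow> u \<noteq> v \<Longrightarrow>
      {u, v} \<in> E \<longleftrightarrow> (\<forall>i<k. {l u i..r u i} \<inter> {l v i..r v i} \<noteq> {})"
  shows "boxicity V E \<le> k"
proof -
  have "box_representation k V E (\<lambda>v. \<Pi>\<^sub>E i\<in>{..<k}. {l v i..r v i})"
    unfolding box_representation_def intersection_representation_def box_meet_iff k_box_def
    using assms by blast
  then show ?thesis
    unfolding boxicity_def by (intro Least_le) blast
qed

theorem theorem5p4:
  fixes V :: "'a set" and E :: "'a set set"
  assumes "circular_arc_graph V E"
    and "max_circular_cover_number V E > 4"
  shows "boxicity V E \<le> 3"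
proof -
  obtain F where F: "arc_representation V E F" and cover: "circular_cover_number V F > 4"
    using assms(2) by (auto simp: max_circular_cover_number_def less_SUP_iff)
  have "\<forall>v\<in>V. \<exists>a b. F v = cis ` {a..b} \<and> a < b \<and> b < a + 2 * pi \<and>
      (a \<le> 0 \<and> 0 \<le> b \<or> 0 < a \<and> b < 2 * pi)"
    using F by (metis arc_representation_def circle_arc_cut_at_one)
  then obtain a b where arc: "\<And>v. v \<in> V \<Longrightarrow> F v = cis ` {a v..b v}"
    and less: "\<And>v. v \<in> V \<Longrightarrow> a v < b v" "\<And>v. v \<in> V \<Longrightarrow> b v < a v + 2 * pi"
    and cut: "\<And>v. v \<in> V \<Longrightarrow> a v \<le> 0 \<and> 0 \<le> b v \<or> 0 < a v \<and> b v < 2 * pi"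
    by metis
  \<comment> \<open>By \<open>cut\<close>, the sign of \<open>a v\<close> alone tells whether the
    arc contains 1. The set \<open>M\<close> collects the remaining arcs that some member of
    \<open>K\<close> reaches at their right end.\<close>
  define K where "K = {v \<in> V. a v \<le> 0}"
  define M where "M = {v \<in> V - K. \<exists>w\<in>K. a w + 2 * pi \<le> b v}"
  have in_K: "v \<in> V" "a v \<le> 0" "0 \<le> b v" "b v < 2 * pi" "- (2 * pi) < a v" if "v \<in> K" for v
    using that less[of v] cut[of v] by (auto simp: K_def)
  have not_K: "0 < a v" "b v < 2 * pi" "a v < b v" if "v \<in> V" "v \<notin> K" for v
    using that less[of v] cut[of v] by (auto simp: K_def)
  have edge: "{u, v} \<in> E \<longleftrightarrow> cis ` {a u..b u} \<inter> cis ` {a v..b v} \<noteq> {}"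
    if "u \<in> V" "v \<in> V" "u \<noteq> v" for u v
    using F that arc by (auto simp: arc_representation_def intersection_representation_def)
  have edge_K: "{u, v} \<in> E \<longleftrightarrow> (if v \<in> M then a u + 2 * pi \<le> b v else a v \<le> b u)"
    if u: "u \<in> K" and v: "v \<in> V" "v \<notin> K" for u v
  proof -
    \<comment> \<open>Otherwise \<open>u'\<close> at the left end of \<open>v\<close> and the
      witness \<open>w\<close> of \<open>v \<in> M\<close> at its right end would complete a cover
      by three arcs.\<close>
    have one_side: "\<not> a v \<le> b u'" if u': "u' \<in> K" and "v \<in> M" for u'
    proof
      assume "a v \<le> b u'"
      moreover obtain w where w: "w \<in> K" "a w + 2 * pi \<le> b v"
        using \<open>v \<in> M\<close> by (auto simp: M_def)
      ultimately have "F u' \<union> F w \<union> F v = sphere 0 1"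
        using three_arcs_cover[of "a u'" "b u'" "a w" "b w" "a v" "b v"] in_K u' arc v by simp
      then show False
        using three_arcs_not_cover[OF cover] in_K u' w v by blast
    qed
    have "{u, v} \<in> E \<longleftrightarrow> a v \<le> b u \<or> a u + 2 * pi \<le> b v"
      using edge[of u v] arc_through_one_meets_iff[of "a u" "b u" "a v" "b v"]
        in_K[OF u] not_K[OF v] less[of u] u v by auto
    then show ?thesis
      using one_side[OF u] u v by (auto simp: M_def)
  qed
  \<comment> \<open>Coordinate 1 gives \<open>[0, b v]\<close> to \<open>K\<close>,
    \<open>[0, 2 pi]\<close> to \<open>M\<close> and \<open>[a v, 2 pi]\<close> to the others, so it
    tests contact at left ends. Coordinate 2 gives \<open>[a v + 2 pi, 2 pi]\<close> to
    \<open>K\<close>, \<open>[0, b v]\<close> to \<open>M\<close> and \<open>[0, 2 pi]\<close> to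
    the others, so it tests contact at right ends.\<close>
  define l where "l v i = (if i = 0 then (if v \<in> K then 0 else a v)
    else if i = 1 then (if v \<in> K \<or> v \<in> M then 0 else a v)
    else (if v \<in> K then a v + 2 * pi else 0))" for v and i :: nat
  define r where "r v i = (if i = 0 then (if v \<in> K then 2 * pi else b v)
    else if i = 1 then (if v \<in> K then b v else 2 * pi)
    else (if v \<in> M then b v else 2 * pi))" for v and i :: nat
  have M_not_K: "v \<notin> K" if "v \<in> M" for v
    using that by (auto simp: M_def)
  have three: "(\<forall>i<3. P i) \<longleftrightarrow> P 0 \<and> P 1 \<and> P 2" for P :: "nat \<Rightarrow> bool"
    by (auto simp: less_Suc_eq numeral_3_eq_3 numeral_2_eq_2)
  let ?meet = "\<lambda>u v. \<forall>i<3. {l u i..r u i} \<inter> {l v i..r v i} \<noteq> {}"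
  \<comment> \<open>Only one coordinate can separate such a pair: 2 if \<open>v \<in> M\<close>, and
    1 otherwise. Its condition is the one in \<open>edge_K\<close>.\<close>
  have box_K: "{u, v} \<in> E \<longleftrightarrow> ?meet u v" if "u \<in> K" "v \<in> V" "v \<notin> K" for u v
    using edge_K[OF that] in_K[OF that(1)] not_K[OF that(2,3)] that
    by (auto simp: three l_def r_def M_not_K)
  show ?thesis
  proof (rule boxicity_le[of V 3 l r])
    fix v and i :: nat assume "v \<in> V" "i < 3"
    then show "l v i \<le> r v i"
      using in_K[of v] not_K[of v] M_not_K[of v] by (auto simp: l_def r_def)
  next
    fix u v assume uv: "u \<in> V" "v \<in> V" "u \<noteq> v"
    consider "u \<in> K" "v \<in> K" | "u \<in> K" "v \<notin> K" | "u \<notin> K" "v \<in> K" | "u \<notin> K" "v \<notin> K"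
      by blast
    then show "{u, v} \<in> E \<longleftrightarrow> ?meet u v"
    proof cases
      case 1
      then have "cis 0 \<in> cis ` {a u..b u} \<inter> cis ` {a v..b v}"
        using in_K by (intro IntI imageI) auto
      then have "{u, v} \<in> E"
        using edge[OF uv] by blast
      moreover have "?meet u v"
        using 1 in_K[of u] in_K[of v] M_not_K by (auto simp: three l_def r_def)
      ultimately show ?thesis
        by simp
    next
      case 2
      then show ?thesis
        using box_K uv by blast
    next
      case 3
      then show ?thesis
        using box_K[of v u] uv by (simp add: insert_commute Int_commute)
    next
      case 4
      \<comment> \<open>Outside \<open>K\<close> all intervals share \<open>2 * pi\<close> in
        coordinate 1 and 0 in coordinate 2, so coordinate 0 decides.\<close>
      have "{u, v} \<in> E \<longleftrightarrow> {a u..b u} \<inter> {a v..b v} \<noteq> {}"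
        using edge[OF uv] cis_images_meet_iff_intervals_meet not_K uv 4 by simp
      then show ?thesis
        using 4 uv not_K[of u] not_K[of v] by (auto simp: three l_def r_def)
    qed
  qed
qed

end
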